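(* Let $p,N\ge1$ be integers, $H=[h_1,\dots,h_N]\in\mathbb{R}^{p\times N}$, $\alpha_1,\dots,\alpha_N>0$, and let $\ell(V)=-\log\det[I+(H+V)^\top(H+V)]$ on the product of spheres $\mathcal{M}=\mathcal{M}_1\times\cdots\times\mathcal{M}_N$, $\mathcal{M}_i=\{v\in\mathbb{R}^p:\|v\|_2^2=\alpha_i\}$. Let $\bar\alpha=\sum_{i=1}^N\alpha_i$, $\alpha_{\min}=\min_i\alpha_i$, $$L_i=2+4(\|H\|_F+\sqrt{\bar\alpha})^2+\frac{2}{\sqrt{\alpha_i}}(\|H\|_F+\sqrt{\bar\alpha}),\qquad L=2+4(\|H\|_F+\sqrt{\bar\alpha})^2+\frac{2}{\sqrt{\alpha_{\min}}}(\|H\|_F+\sqrt{\bar\alpha}),$$ $L_{\min}=\min_iL_i$, $L_{\max}=\max_iL_i$, and $$C=\frac{L_{\min}^2}{4L_{\max}\big(L_{\min}^2+L^2N(N-1)\big)}.$$ Let $V^{(k)}=[v_1^{(k)},\dots,v_N^{(k)}]$, $k\ge0$, be the sequence generated by the cyclic Riemannian block coordinate descent algorithm (described in the context) with learning rates $\eta_i=1/L_i$ for $i=1,\dots,N$. Then: (1) $\lim_{k\to\infty}\|\mathrm{grad}\,\ell(V^{(k)})\|_F=0$, and for every $k\ge1$, $$\min_{0\le s\le k}\|\mathrm{grad}\,\ell(V^{(s)})\|_F\le\sqrt{\frac{\ell(V^{(0)})-\ell^\star}{Ck}},$$ where $\ell^\star=\min_{V\in\mathcal{M}}\ell(V)$.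 (2) Any limit point $V^\infty\in\mathcal{M}$ of $\{V^{(k)}\}_{k\ge1}$ is a stationary point, i.e. $\mathrm{grad}\,\ell(V^\infty)=0$.
   Context: $\|\cdot\|_F$ is the Frobenius norm, $\|\cdot\|_2$ the Euclidean norm. $\mathcal{M}$ is viewed as a Riemannian submanifold of $\mathbb{R}^{p\times N}$ with the induced Euclidean (Frobenius) metric, and $\mathrm{grad}\,\ell(V)$ denotes the Riemannian gradient of $\ell$ restricted to $\mathcal{M}$; its $i$-th column is the orthogonal projection $(I-\frac1{\alpha_i}v_iv_i^\top)g_i$ of the $i$-th column $g_i=\nabla_i\ell(V)$ of the Euclidean gradient of $\ell$ onto the tangent space $T_{v_i}\mathcal{M}_i=\{z\in\mathbb{R}^p:z^\top v_i=0\}$. Algorithm (Riemannian block coordinate descent on a product of spheres with exponential maps), run for iterations $k=1,2,\dots$: Initialization: for each $i$, $v_i^{(0)}=\sqrt{\alpha_i}\,\dfrac{h_i+\varepsilon_i-\bar h}{\|h_i+\varepsilon_i-\bar h\|_2}$, where $\bar h=\frac1N\sum_{j=1}^Nh_j$ and $\varepsilon_1,\dots,\varepsilon_N\in\mathbb{R}^p$ are realizations of independent isotropic centered Gaussian noise (with $h_i+\varepsilon_i-\bar h\ne0$). Iteration $k$: for $i=1,\dots,N$ in order, set $g_i=\nabla_i\ell(v_1^{(k)},\dots,v_{i-1}^{(k)},v_i^{(k-1)},v_{i+1}^{(k-1)},\dots,v_N^{(k-1)})$ (Euclidean gradient with respect to the $i$-th column), $d_i=-g_i+\frac1{\alpha_i}\big((v_i^{(k-1)})^\top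 g_i\big)v_i^{(k-1)}$, and $$v_i^{(k)}=\cos\Big(\frac{\eta_i\|d_i\|_2}{\sqrt{\alpha_i}}\Big)v_i^{(k-1)}+\sin\Big(\frac{\eta_i\|d_i\|_2}{\sqrt{\alpha_i}}\Big)\frac{d_i}{\|d_i\|_2}\sqrt{\alpha_i},$$ i.e. $v_i^{(k)}$ is the Riemannian exponential of $\eta_id_i$ at $v_i^{(k-1)}$ on $\mathcal{M}_i$; when $d_i=0$ this means $v_i^{(k)}=v_i^{(k-1)}$. *)

theory Defs
  imports "HOL-Analysis.Analysis"
begin

text \<open>
  A matrix with \<open>p\<close> rows and \<open>N\<close> columns has type \<^typ>\<open>real^'n^'p\<close>. The norm and inner product of
  this type are the Frobenius ones. The columns are indexed by a finite linearly ordered type, whose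
  order is the order in which the cyclic method visits the blocks.
\<close>

definition of_columns :: "('n \<Rightarrow> real^'p) \<Rightarrow> real^'n^'p" where
  "of_columns c = (\<chi> r i. c i $ r)"

definition set_column :: "real^'n^'p \<Rightarrow> 'n \<Rightarrow> real^'p \<Rightarrow> real^'n^'p" where
  "set_column V i x = of_columns (\<lambda>j. if j = i then x else column j V)"

definition objective :: "real^'n^'p \<Rightarrow> real^'n^'p \<Rightarrow> real" where
  "objective H V = - ln (det (mat 1 + transpose (H + V) ** (H + V)))"

definition sphere_product :: "('n \<Rightarrow> real) \<Rightarrow> (real^'n^'p) set" where
  "sphere_product \<alpha> = {V. \<forall>i. (norm (column i V))\<^sup>2 = \<alpha> i}"

definition tangent_space :: "real^'n^'p \<Rightarrow> (real^'n^'p) set" where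
  "tangent_space V = {Z. \<forall>i. column i Z \<bullet> column i V = 0}"

text \<open>
  The least element of the set of values on the product of spheres; lemma \<open>objective_min_attained\<close>
  below shows that it exists.
\<close>

definition objective_min :: "real^'n^'p \<Rightarrow> ('n \<Rightarrow> real) \<Rightarrow> real" where
  "objective_min H \<alpha> = (LEAST y. y \<in> objective H ` sphere_product \<alpha>)"

definition euclidean_grad :: "(real^'n^'p \<Rightarrow> real) \<Rightarrow> real^'n^'p \<Rightarrow> real^'n^'p" where
  "euclidean_grad f V = (THE D. GDERIV f V :> D)"

definition tangent_proj :: "real \<Rightarrow> real^'p \<Rightarrow> real^'p \<Rightarrow> real^'p" where
  "tangent_proj a v g = g - (1 / a) *\<^sub>R ((v \<bullet> g) *\<^sub>R v)"

text \<open>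
  Columnwise orthogonal projection of the Euclidean gradient onto the tangent space. On the product
  of spheres this is the Riemannian gradient for the induced metric; see lemma
  \<open>riemannian_grad_unique\<close> below.
\<close>

definition riemannian_grad ::
    "('n \<Rightarrow> real) \<Rightarrow> (real^'n^'p \<Rightarrow> real) \<Rightarrow> real^'n^'p \<Rightarrow> real^'n^'p" where
  "riemannian_grad \<alpha> f V =
     of_columns (\<lambda>i. tangent_proj (\<alpha> i) (column i V) (column i (euclidean_grad f V)))"

definition init_direction :: "real^'n^'p \<Rightarrow> ('n \<Rightarrow> real^'p) \<Rightarrow> 'n \<Rightarrow> real^'p" where
  "init_direction H \<epsilon> i =
     column i H + \<epsilon> i - (1 / real CARD('n)) *\<^sub>R (\<Sum>j\<in>UNIV. column j H)"

definition rbcd_init :: "real^'n^'p \<Rightarrow> ('n \<Rightarrow> real) \<Rightarrow> ('n \<Rightarrow> real^'p) \<Rightarrow> real^'n^'p" where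
  "rbcd_init H \<alpha> \<epsilon> =
     of_columns (\<lambda>i. (sqrt (\<alpha> i) / norm (init_direction H \<epsilon> i)) *\<^sub>R init_direction H \<epsilon> i)"

definition rbcd_update ::
    "real^'n^'p \<Rightarrow> ('n \<Rightarrow> real) \<Rightarrow> ('n \<Rightarrow> real) \<Rightarrow> 'n \<Rightarrow> real^'n^'p \<Rightarrow> real^'n^'p" where
  "rbcd_update H \<alpha> \<eta> i V =
     (let v = column i V;
          g = column i (euclidean_grad (objective H) V);
          d = - g + (1 / \<alpha> i) *\<^sub>R ((v \<bullet> g) *\<^sub>R v);
          \<theta> = \<eta> i * norm d / sqrt (\<alpha> i)
      in set_column V i
           (if d = 0 then v
            else cos \<theta> *\<^sub>R v + sin \<theta> *\<^sub>R (sqrt (\<alpha> i) *\<^sub>R ((1 / norm d) *\<^sub>R d))))"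

text \<open>
  One iteration updates the blocks successively in increasing order, each update being applied to
  the matrix that already contains the preceding new blocks.
\<close>

definition rbcd_sweep ::
    "real^('n::{finite,linorder})^'p \<Rightarrow> ('n \<Rightarrow> real) \<Rightarrow> ('n \<Rightarrow> real) \<Rightarrow> real^('n::{finite,linorder})^'p \<Rightarrow> real^('n::{finite,linorder})^'p" where
  "rbcd_sweep H \<alpha> \<eta> V = fold (rbcd_update H \<alpha> \<eta>) (sorted_list_of_set UNIV) V"

definition rbcd_iterate ::
    "real^('n::{finite,linorder})^'p \<Rightarrow> ('n \<Rightarrow> real) \<Rightarrow> ('n \<Rightarrow> real) \<Rightarrow> ('n \<Rightarrow> real^'p)
      \<Rightarrow> nat \<Rightarrow> real^('n::{finite,linorder})^'p" where
  "rbcd_iterate H \<alpha> \<eta> \<epsilon> k = (rbcd_sweep H \<alpha> \<eta> ^^ k) (rbcd_init H \<alpha> \<epsilon>)"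

definition radius_bound :: "real^'n^'p \<Rightarrow> ('n \<Rightarrow> real) \<Rightarrow> real" where
  "radius_bound H \<alpha> = norm H + sqrt (\<Sum>i\<in>UNIV. \<alpha> i)"

definition block_lip :: "real^'n^'p \<Rightarrow> ('n \<Rightarrow> real) \<Rightarrow> 'n \<Rightarrow> real" where
  "block_lip H \<alpha> i = 2 + 4 * (radius_bound H \<alpha>)\<^sup>2 + 2 / sqrt (\<alpha> i) * radius_bound H \<alpha>"

definition global_lip :: "real^'n^'p \<Rightarrow> ('n \<Rightarrow> real) \<Rightarrow> real" where
  "global_lip H \<alpha> =
     2 + 4 * (radius_bound H \<alpha>)\<^sup>2 + 2 / sqrt (Min (range \<alpha>)) * radius_bound H \<alpha>"

definition rate_const :: "real^'n^'p \<Rightarrow> ('n \<Rightarrow> real) \<Rightarrow> real" where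
  "rate_const H \<alpha> =
     (let Lmin = Min (range (block_lip H \<alpha>));
          Lmax = Max (range (block_lip H \<alpha>));
          L = global_lip H \<alpha>;
          N = real CARD('n)
      in Lmin\<^sup>2 / (4 * Lmax * (Lmin\<^sup>2 + L\<^sup>2 * (N * (N - 1)))))"


subsection \<open>Well-definedness\<close>

lemma column_of_columns [simp]: "column i (of_columns c) = c i"
  by (simp add: of_columns_def column_def vec_eq_iff)

lemma column_diff: "column i (A - B) = column i A - column i (B :: real^'n^'p)"
  by (simp add: column_def vec_eq_iff)

lemma matrix_eq_columns: "A = B \<longleftrightarrow> (\<forall>i. column i A = column i (B :: real^'n^'p))"
  by (auto simp: column_def vec_eq_iff)

lemma inner_columns: "A \<bullet> B = (\<Sum>i\<in>UNIV. column i A \<bullet> column i (B :: real^'n^'p))"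
  unfolding inner_vec_def column_def by (simp, rule sum.swap)

lemma gram_det_pos:
  fixes A :: "real^'n^'p"
  shows "det (mat 1 + transpose A ** A) > 0"
proof -
  define F where "F = (\<lambda>t::real. det (mat 1 + t *\<^sub>R (transpose A ** A)))"
  have nz: "F t \<noteq> 0" if "0 \<le> t" for t
  proof -
    have "x = 0" if "(mat 1 + t *\<^sub>R (transpose A ** A)) *v x = 0" for x
    proof -
      have "x + t *\<^sub>R (transpose A *v (A *v x)) = 0"
        using that
        by (simp add: matrix_vector_mult_add_rdistrib scaleR_matrix_vector_assoc[symmetric]
            matrix_vector_mul_assoc)
      hence "x \<bullet> (x + t *\<^sub>R (transpose A *v (A *v x))) = 0" by simp
      hence "x \<bullet> x + t * ((A *v x) \<bullet> (A *v x)) = 0"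
        by (simp add: inner_add_right dot_lmul_matrix[symmetric] vector_transpose_matrix
            flip: transpose_matrix_vector)
      moreover have "t * ((A *v x) \<bullet> (A *v x)) \<ge> 0" using \<open>0 \<le> t\<close> by simp
      ultimately show "x = 0" by (smt (verit) inner_gt_zero_iff)
    qed
    thus ?thesis
      unfolding F_def invertible_det_nz[symmetric] invertible_left_inverse matrix_left_invertible_ker
      by blast
  qed
  have cont: "continuous_on {0..1} F"
    unfolding F_def det_def by (intro continuous_intros)
  have "F 0 = 1" by (simp add: F_def)
  have "F 1 > 0"
  proof (rule ccontr)
    assume "\<not> F 1 > 0"
    then obtain t where "0 \<le> t" "F t = 0"
      using IVT2'[of F 1 0 0] cont \<open>F 0 = 1\<close> by auto
    thus False using nz by blast
  qed
  thus ?thesis by (simp add: F_def)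
qed

lemma objective_differentiable:
  fixes H V :: "real^'n^'p"
  shows "objective H differentiable (at V)"
proof -
  have entry: "(\<lambda>V. V $ k $ i) differentiable (at V)" for k i
    by (intro bounded_linear_imp_differentiable bounded_linear_compose[OF bounded_linear_vec_nth]
        bounded_linear_vec_nth)
  have prod: "(\<lambda>V. \<Prod>i\<in>UNIV. f i V) differentiable (at V)"
    if f: "\<And>i. f i differentiable (at V)" for f :: "'n \<Rightarrow> real^'n^'p \<Rightarrow> real"
  proof -
    obtain F where "\<And>i. (f i has_derivative F i) (at V)"
      using f unfolding differentiable_def by metis
    hence "((\<lambda>V. \<Prod>i\<in>UNIV. f i V) has_derivative
        (\<lambda>h. \<Sum>i\<in>UNIV. F i h * (\<Prod>j\<in>UNIV - {i}. f j V))) (at V)"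
      by (rule has_derivative_prod)
    thus ?thesis unfolding differentiable_def by blast
  qed
  have "(\<lambda>V. \<Sum>q | q permutes UNIV. of_int (sign q) *
      (\<Prod>i\<in>UNIV. (if i = q i then 1 else 0) +
        (\<Sum>k\<in>UNIV. (H $ k $ i + V $ k $ i) * (H $ k $ q i + V $ k $ q i)))) differentiable (at V)"
    by (intro differentiable_sum differentiable_mult differentiable_const prod differentiable_add
        entry ballI finite finite_permutations)
  hence "(\<lambda>V. det (mat 1 + transpose (H + V) ** (H + V))) differentiable (at V)"
    by (simp add: det_def matrix_matrix_mult_def transpose_def mat_def)
  then obtain D where
    "((\<lambda>V. det (mat 1 + transpose (H + V) ** (H + V))) has_derivative D) (at V)"
    by (auto simp: differentiable_def)
  from has_derivative_minus[OF has_derivative_ln[OF gram_det_pos this]] show ?thesis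
    unfolding differentiable_def objective_def by blast
qed

lemma euclidean_grad_eq:
  assumes "GDERIV f V :> D"
  shows "euclidean_grad f V = D"
  unfolding euclidean_grad_def
proof (rule the_equality[where P = "\<lambda>D. GDERIV f V :> D", OF assms])
  fix E assume "GDERIV f V :> E"
  hence "(\<lambda>h. h \<bullet> E) = (\<lambda>h. h \<bullet> D)"
    using assms has_derivative_unique unfolding gderiv_def by blast
  hence "h \<bullet> E = h \<bullet> D" for h by meson
  thus "E = D" by (metis vector_eq_ldot)
qed

lemma objective_gderiv: "GDERIV (objective H) V :> euclidean_grad (objective H) V"
proof -
  obtain F where F: "(objective H has_derivative F) (at V)"
    using objective_differentiable differentiable_def by blast
  have "linear F" using F has_derivative_linear by blast
  have "F h = h \<bullet> adjoint F 1" for h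
    using adjoint_works[OF \<open>linear F\<close>, of h 1] by simp
  hence "(\<lambda>h. h \<bullet> adjoint F 1) = F" by auto
  hence D: "GDERIV (objective H) V :> adjoint F 1"
    unfolding gderiv_def using F by (simp only:)
  show ?thesis unfolding euclidean_grad_eq[OF D] by (rule D)
qed

lemma riemannian_grad_unique:
  assumes pos: "\<And>i. \<alpha> i > 0" and V: "V \<in> sphere_product \<alpha>"
  shows "G = riemannian_grad \<alpha> f V \<longleftrightarrow>
    G \<in> tangent_space V \<and> (\<forall>Z\<in>tangent_space V. Z \<bullet> G = Z \<bullet> euclidean_grad f V)"
proof -
  have vv: "column i V \<bullet> column i V = \<alpha> i" for i
    using V by (simp add: sphere_product_def power2_norm_eq_inner)
  have R: "column i (riemannian_grad \<alpha> f V) =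
      tangent_proj (\<alpha> i) (column i V) (column i (euclidean_grad f V))" for i
    by (simp add: riemannian_grad_def)
  have tan: "riemannian_grad \<alpha> f V \<in> tangent_space V"
    unfolding tangent_space_def mem_Collect_eq R
  proof
    fix i
    have "\<alpha> i \<noteq> 0" using pos[of i] by simp
    thus "tangent_proj (\<alpha> i) (column i V) (column i (euclidean_grad f V)) \<bullet> column i V = 0"
      by (simp add: tangent_proj_def inner_diff_left vv) (simp add: inner_commute)
  qed
  have rep: "Z \<bullet> riemannian_grad \<alpha> f V = Z \<bullet> euclidean_grad f V" if "Z \<in> tangent_space V" for Z
    using that unfolding inner_columns
    by (intro sum.cong) (auto simp: tangent_space_def R tangent_proj_def inner_diff_right)
  have "G = riemannian_grad \<alpha> f V"
    if G: "G \<in> tangent_space V" "\<forall>Z\<in>tangent_space V. Z \<bullet> G = Z \<bullet> euclidean_grad f V"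
  proof -
    let ?Z = "G - riemannian_grad \<alpha> f V"
    have Z: "?Z \<in> tangent_space V"
      using G(1) tan by (simp add: tangent_space_def column_diff inner_diff_left)
    have "?Z \<bullet> ?Z = 0"
      using rep[OF Z] G(2) Z by (simp add: inner_diff_right)
    thus ?thesis by simp
  qed
  thus ?thesis using tan rep by blast
qed

lemma objective_min_attained:
  fixes H :: "real^'n^'p"
  assumes pos: "\<And>i. \<alpha> i > 0"
  shows "\<exists>V\<in>sphere_product \<alpha>. objective H V = objective_min H \<alpha> \<and>
    (\<forall>W\<in>sphere_product \<alpha>. objective_min H \<alpha> \<le> objective H W)"
proof -
  let ?S = "sphere_product \<alpha> :: (real^'n^'p) set"
  have "bounded ?S"
  proof (rule boundedI)
    fix V :: "real^'n^'p" assume "V \<in> ?S"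
    hence "(norm V)\<^sup>2 = sum \<alpha> UNIV"
      by (simp add: sphere_product_def power2_norm_eq_inner inner_columns)
    thus "norm V \<le> sqrt (sum \<alpha> UNIV)" by (metis norm_ge_zero order_refl real_sqrt_unique)
  qed
  moreover have "closed ?S"
    unfolding sphere_product_def column_def
    by (intro closed_Collect_all closed_Collect_eq continuous_intros)
  ultimately have "compact ?S" by (simp add: compact_eq_bounded_closed)
  moreover have "of_columns (\<lambda>i. sqrt (\<alpha> i) *\<^sub>R axis undefined 1) \<in> ?S"
    using pos by (simp add: sphere_product_def less_imp_le power_mult_distrib)
  moreover have "continuous_on ?S (objective H)"
    by (meson continuous_at_imp_continuous_on differentiable_imp_continuous_within
        objective_differentiable)
  ultimately obtain V where V: "V \<in> ?S" "\<forall>W\<in>?S. objective H V \<le> objective H W"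
    using continuous_attains_inf[of ?S "objective H"] by blast
  have "objective_min H \<alpha> = objective H V"
    unfolding objective_min_def by (rule Least_equality) (use V in auto)
  thus ?thesis using V by metis
qed

end

theory Submission
  imports Defs
begin

text \<open>
  Put \<open>A = H + V\<close>. Jacobi's formula at the identity gives the Euclidean gradient
  \<open>- 2 A (I + A\<^sup>T A)\<^sup>-\<^sup>1\<close>. Since \<open>(I + A\<^sup>T A)\<^sup>-\<^sup>1\<close> is a contraction, this gradient is bounded by
  \<open>2 R\<close> and Lipschitz with constant \<open>2 + 4 R\<^sup>2\<close> as long as the norm of \<open>A\<close> is at most \<open>R\<close>.
  Along a geodesic of the \<open>i\<close>-th sphere with velocity \<open>d\<close>, the gradient changes at rate at most
  \<open>(2 + 4 R\<^sup>2) \<parallel>d\<parallel>\<close> and the velocity at rate \<open>\<parallel>d\<parallel>\<^sup>2 / \<surd>\<alpha>\<^sub>i\<close>; the two contributions add up to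
  \<open>L\<^sub>i\<close>, so a step of length \<open>1 / L\<^sub>i\<close> decreases the objective by \<open>\<parallel>d\<parallel>\<^sup>2 / (2 L\<^sub>i)\<close>. When block \<open>i\<close>
  is visited, its own column is still the old one, so the \<open>i\<close>-th column of the Riemannian gradient
  has moved by at most the Lipschitz constant times the length of the preceding steps of the sweep.
  Hence a full sweep decreases the objective by \<open>C\<close> times the squared gradient norm at its
  starting point, and the decreases telescope.
\<close>

section \<open>Derivative of the determinant at the identity\<close>

text \<open>In the Leibniz expansion the product rule differentiates one factor and evaluates the
  others at the identity matrix. For a permutation other than the identity one of those others is
  zero, so only the diagonal term survives.\<close>

lemma has_derivative_det_mat_1:
  "(det has_derivative trace) (at (mat 1 :: real^'n^'n))"
proof -
  let ?I = "mat 1 :: real^'n^'n"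
  let ?D = "\<lambda>q (X::real^'n^'n). \<Sum>i\<in>UNIV. X $ i $ q i * (\<Prod>j\<in>UNIV - {i}. ?I $ j $ q j)"
  have entry: "((\<lambda>X :: real^'n^'n. X $ i $ j) has_derivative (\<lambda>X. X $ i $ j)) F" for i j F
    by (intro bounded_linear_imp_has_derivative bounded_linear_compose[OF bounded_linear_vec_nth]
        bounded_linear_vec_nth)
  have prod: "((\<lambda>X. \<Prod>i\<in>UNIV. X $ i $ q i) has_derivative ?D q) (at ?I)" for q
    by (rule has_derivative_prod) (rule entry)
  have "((\<lambda>X. \<Sum>q | q permutes UNIV. of_int (sign q) * (\<Prod>i\<in>UNIV. X $ i $ q i)) has_derivative
      (\<lambda>X. \<Sum>q | q permutes UNIV. of_int (sign q) * ?D q X)) (at ?I)"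
    by (intro has_derivative_sum has_derivative_mult_right prod)
  moreover have "(\<Sum>q | q permutes UNIV. of_int (sign q) * ?D q X) = trace X" for X
  proof -
    have off: "?D q X = 0" if q: "q permutes UNIV" "q \<noteq> id" for q
    proof -
      obtain a where a: "q a \<noteq> a" using q(2) by (auto simp: fun_eq_iff)
      \<comment> \<open>By injectivity \<open>q a\<close> is a second moved index, so removing any
        single \<open>i\<close> leaves a moved one: \<open>q a\<close> if \<open>i = a\<close>, and
        \<open>a\<close> otherwise.\<close>
      have "q (q a) \<noteq> q a" using a permutes_inj[OF q(1)] by (auto simp: inj_def)
      hence "\<exists>j\<in>UNIV - {i}. q j \<noteq> j" for i
        using a by (cases "i = a") auto
      hence "\<exists>j\<in>UNIV - {i}. ?I $ j $ q j = 0" for i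
        by (simp add: mat_def) metis
      hence "(\<Prod>j\<in>UNIV - {i}. ?I $ j $ q j) = 0" for i
        by (subst prod_zero_iff) auto
      thus ?thesis by (simp only: mult_zero_right sum.neutral_const)
    qed
    have "(\<Sum>q | q permutes UNIV. of_int (sign q) * ?D q X) =
        (\<Sum>q\<in>{id}. of_int (sign q) * ?D q X)"
      by (intro sum.mono_neutral_right)
        (auto simp: finite_permutations permutes_id off)
    also have "\<dots> = trace X" by (simp add: trace_def mat_def sign_id)
    finally show ?thesis .
  qed
  ultimately show ?thesis by (simp add: det_def[abs_def])
qed

section \<open>Frobenius norm and matrix products\<close>

lemma norm_transpose: "norm (transpose A) = norm (A :: real^'n^'p)"
  unfolding norm_eq_sqrt_inner inner_vec_def transpose_def by (simp, rule sum.swap)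

lemma norm_eq_columns: "(norm (A :: real^'n^'p))\<^sup>2 = (\<Sum>i\<in>UNIV. (norm (column i A))\<^sup>2)"
  by (simp add: power2_norm_eq_inner inner_columns)

lemma column_matrix_mult: "column i (A ** B) = A *v column i (B :: real^'n^'m)"
  by (simp add: column_def matrix_matrix_mult_def matrix_vector_mult_def vec_eq_iff)

lemma norm_matrix_vector_le: "norm ((A :: real^'n^'m) *v x) \<le> norm A * norm x"
proof -
  have "(norm (A *v x))\<^sup>2 = (\<Sum>i\<in>UNIV. (A $ i \<bullet> x)\<^sup>2)"
    unfolding power2_norm_eq_inner
    by (simp add: inner_vec_def matrix_vector_mult_def power2_eq_square)
  also have "\<dots> \<le> (\<Sum>i\<in>UNIV. (norm (A $ i))\<^sup>2 * (norm x)\<^sup>2)"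
    by (intro sum_mono) (metis abs_le_square_iff abs_norm_cancel Cauchy_Schwarz_ineq2 power_mult_distrib abs_mult)
  also have "\<dots> = (norm A * norm x)\<^sup>2"
    by (simp add: power_mult_distrib sum_distrib_right[symmetric] power2_norm_eq_inner
        inner_vec_def[of A])
  finally show ?thesis by (rule power2_le_imp_le) simp
qed

text \<open>The vector bound, applied to each column of \<open>B\<close>, sums to a Frobenius bound.
  The general \<open>c\<close> serves two cases: \<open>norm A\<close> for submultiplicativity, and
  \<open>1\<close> for the contraction \<open>gram_inv A\<close>.\<close>

lemma norm_matrix_mult_le_onorm:
  fixes A :: "real^'n^'m" and B :: "real^'k^'n"
  assumes "\<And>x. norm (A *v x) \<le> c * norm x" "c \<ge> 0"
  shows "norm (A ** B) \<le> c * norm B"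
proof (rule power2_le_imp_le)
  have "(norm (A ** B))\<^sup>2 \<le> (\<Sum>i\<in>UNIV. (c * norm (column i B))\<^sup>2)"
    unfolding norm_eq_columns[of "A ** B"] column_matrix_mult
    by (intro sum_mono power_mono assms) auto
  also have "\<dots> = (c * norm B)\<^sup>2"
    by (simp add: power_mult_distrib norm_eq_columns[of B] sum_distrib_left)
  finally show "(norm (A ** B))\<^sup>2 \<le> (c * norm B)\<^sup>2" .
qed (use assms(2) in simp)

lemma norm_matrix_mult_le: "norm ((A :: real^'n^'m) ** B) \<le> norm A * norm (B :: real^'k^'n)"
  by (rule norm_matrix_mult_le_onorm[OF norm_matrix_vector_le]) simp

section \<open>The regularized Gram matrix and its inverse\<close>

definition gram :: "real^'n^'p \<Rightarrow> real^'n^'n" where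
  "gram A = mat 1 + transpose A ** A"

definition gram_inv :: "real^'n^'p \<Rightarrow> real^'n^'n" where
  "gram_inv A = matrix_inv (gram A)"

lemma gram_inv_right: "gram A ** gram_inv A = mat 1"
  and gram_inv_left: "gram_inv A ** gram A = mat 1"
proof -
  have "invertible (gram A)"
    using gram_det_pos[of A] by (simp add: invertible_det_nz gram_def)
  hence "gram A ** gram_inv A = mat 1 \<and> gram_inv A ** gram A = mat 1"
    unfolding gram_inv_def matrix_inv_def invertible_def by (rule someI_ex)
  thus "gram A ** gram_inv A = mat 1" "gram_inv A ** gram A = mat 1" by auto
qed

lemma transpose_add: "transpose (A + B) = transpose A + transpose (B :: real^'n^'p)"
  by (simp add: transpose_def vec_eq_iff)

lemma transpose_gram: "transpose (gram A) = gram A"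
  by (simp add: gram_def transpose_add matrix_transpose_mul transpose_mat)

lemma transpose_gram_inv: "transpose (gram_inv A) = gram_inv A"
proof -
  have "transpose (gram_inv A) ** gram A = mat 1"
    by (metis gram_inv_right matrix_transpose_mul transpose_gram transpose_mat)
  thus ?thesis
    by (metis gram_inv_right matrix_mul_assoc matrix_mul_lid matrix_mul_rid)
qed

text \<open>Testing \<open>x = gram A *v y\<close> against \<open>y\<close> gives the squared norms
  of \<open>y\<close> and \<open>A *v y\<close> on one side and \<open>y \<bullet> x\<close> on the
  other; Cauchy-Schwarz then bounds \<open>norm y\<close>.\<close>

lemma norm_gram_inv_le: "norm (gram_inv A *v x) \<le> norm x"
proof -
  define y where "y = gram_inv A *v x"
  have x: "x = gram A *v y"
    by (simp add: y_def matrix_vector_mul_assoc gram_inv_right)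
  have "y \<bullet> y \<le> y \<bullet> y + (A *v y) \<bullet> (A *v y)" by simp
  also have "\<dots> = y \<bullet> x"
    unfolding x gram_def
    by (simp add: matrix_vector_mult_add_rdistrib inner_add_right matrix_vector_mul_assoc[symmetric]
        dot_lmul_matrix[symmetric] vector_transpose_matrix flip: transpose_matrix_vector)
  also have "\<dots> \<le> norm y * norm x" by (rule norm_cauchy_schwarz)
  finally have "norm y * norm y \<le> norm y * norm x"
    by (simp add: power2_norm_eq_inner[symmetric] power2_eq_square)
  thus ?thesis unfolding y_def[symmetric]
    by (cases "norm y = 0") (auto simp: mult_le_cancel_left)
qed

lemma norm_gram_inv_mult_le: "norm (gram_inv A ** B) \<le> norm B"
  using norm_matrix_mult_le_onorm[of "gram_inv A" 1] norm_gram_inv_le by force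

lemma norm_mult_gram_inv_le: "norm (B ** gram_inv A) \<le> norm (B :: real^'n^'p)"
  by (metis matrix_transpose_mul norm_gram_inv_mult_le norm_transpose transpose_gram_inv)

lemma matrix_mult_diff_left: "(A - B) ** C = A ** C - B ** (C :: real^'k^'n)"
  by (simp add: matrix_matrix_mult_def vec_eq_iff left_diff_distrib sum_subtractf)

lemma matrix_mult_diff_right: "C ** (A - B) = C ** A - C ** (B :: real^'k^'n)"
  by (simp add: matrix_matrix_mult_def vec_eq_iff right_diff_distrib sum_subtractf)

text \<open>The difference splits into \<open>(A - B) ** gram_inv A\<close> and
  \<open>B ** (gram_inv A - gram_inv B)\<close>. Contraction bounds the first; the resolvent
  identity bounds the difference of inverses by \<open>2 * R * norm (A - B)\<close>.\<close>

lemma mult_gram_inv_lipschitz: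
  fixes A B :: "real^'n^'p"
  assumes "norm A \<le> R" "norm B \<le> R"
  shows "norm (A ** gram_inv A - B ** gram_inv B) \<le> (1 + 2 * R\<^sup>2) * norm (A - B)"
proof -
  let ?E = "transpose B ** (B - A) + transpose (B - A) ** A"
  have R: "0 \<le> R" using assms(1) norm_ge_zero order_trans by blast
  \<comment> \<open>Adding and subtracting \<open>transpose B ** A\<close> puts a factor
    \<open>B - A\<close> into both terms. Placing the result between the two inverses then yields
    the resolvent identity.\<close>
  have "gram B - gram A = ?E"
    by (simp add: gram_def matrix_mult_diff_left matrix_mult_diff_right transpose_def
        vec_eq_iff matrix_matrix_mult_def algebra_simps sum_subtractf flip: sum.distrib)
  hence "gram_inv A ** ?E ** gram_inv B = gram_inv A ** (gram B - gram A) ** gram_inv B" by simp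
  also have "\<dots> = gram_inv A ** (gram B ** gram_inv B) - (gram_inv A ** gram A) ** gram_inv B"
    by (simp add: matrix_mult_diff_left matrix_mult_diff_right matrix_mul_assoc)
  also have "\<dots> = gram_inv A - gram_inv B" by (simp add: gram_inv_right gram_inv_left)
  finally have inv: "gram_inv A - gram_inv B = gram_inv A ** ?E ** gram_inv B" ..
  have "A ** gram_inv A - B ** gram_inv B =
      (A - B) ** gram_inv A + B ** (gram_inv A - gram_inv B)"
    by (simp add: matrix_mult_diff_left matrix_mult_diff_right)
  also have "norm \<dots> \<le> norm ((A - B) ** gram_inv A) + norm (B ** (gram_inv A - gram_inv B))"
    by (rule norm_triangle_ineq)
  also have "\<dots> \<le> norm (A - B) + R * (2 * R * norm (A - B))"
  proof (intro add_mono norm_mult_gram_inv_le)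
    have "norm (gram_inv A - gram_inv B) \<le> norm ?E"
      unfolding inv by (meson norm_gram_inv_mult_le norm_mult_gram_inv_le order_trans)
    also have "\<dots> \<le> norm (transpose B) * norm (B - A) + norm (transpose (B - A)) * norm A"
      by (intro norm_triangle_le add_mono norm_matrix_mult_le)
    also have "\<dots> \<le> R * norm (B - A) + norm (B - A) * R"
      using assms by (intro add_mono mult_mono) (auto simp: norm_transpose R)
    also have "\<dots> = 2 * R * norm (A - B)" by (simp add: norm_minus_commute)
    finally have "norm (gram_inv A - gram_inv B) \<le> 2 * R * norm (A - B)" .
    thus "norm (B ** (gram_inv A - gram_inv B)) \<le> R * (2 * R * norm (A - B))"
      using assms R by (intro order_trans[OF norm_matrix_mult_le] mult_mono) auto
  qed
  finally show ?thesis by (simp add: power2_eq_square algebra_simps)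
qed

section \<open>Euclidean gradient of the objective\<close>

lemma inner_matrix_trace: "A \<bullet> B = trace (transpose A ** (B :: real^'n^'p))"
  unfolding inner_vec_def trace_def matrix_matrix_mult_def transpose_def by (simp, rule sum.swap)

lemma bounded_linear_matrix_mult_right: "bounded_linear ((**) (A :: real^'n^'m) :: real^'k^'n \<Rightarrow> _)"
  by (rule linear_conv_bounded_linear[THEN iffD1], rule linearI)
    (simp_all add: matrix_add_ldistrib scalar_matrix_assoc matrix_scalar_ac flip: scalar_mult_eq_scaleR)

lemma has_derivative_gram:
  fixes H V :: "real^'n^'p"
  shows "((\<lambda>V. gram (H + V)) has_derivative
    (\<lambda>Z. transpose (H + V) ** Z + transpose Z ** (H + V))) (at V)"
proof -
  have bil: "bounded_bilinear (\<lambda>(A :: real^'n^'p) (B :: real^'n^'p). transpose A ** B)"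
  proof
    show "\<exists>K. \<forall>A B. norm (transpose (A :: real^'n^'p) ** (B :: real^'n^'p)) \<le> norm A * norm B * K"
      by (rule exI[of _ 1]) (metis norm_matrix_mult_le norm_transpose mult.right_neutral)
  qed (simp_all add: transpose_def matrix_matrix_mult_def vec_eq_iff algebra_simps sum.distrib sum_distrib_left)
  have id: "((\<lambda>V. H + V) has_derivative (\<lambda>Z. Z)) (at V)"
    by (auto intro!: derivative_eq_intros)
  show ?thesis unfolding gram_def
    using bounded_bilinear.FDERIV[OF bil id id]
    by (auto intro!: derivative_eq_intros)
qed

text \<open>The derivative of the determinant has been computed at the identity. The Gram matrix is
  therefore multiplied by its inverse \<open>?W\<close> at the base point, which stays fixed and
  shifts the logarithm only by the constant \<open>ln (det ?W)\<close>.\<close>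

lemma gderiv_objective:
  fixes H V :: "real^'n^'p"
  shows "GDERIV (objective H) V :> - 2 *\<^sub>R ((H + V) ** gram_inv (H + V))"
proof -
  let ?A = "H + V"
  let ?M = "gram ?A" and ?W = "gram_inv ?A"
  have pos: "det (gram B) > 0" for B :: "real^'n^'p" using gram_det_pos[of B] by (simp add: gram_def)
  have d1: "((\<lambda>V. ?W ** gram (H + V)) has_derivative
      (\<lambda>Z. ?W ** (transpose ?A ** Z + transpose Z ** ?A))) (at V)"
    by (rule bounded_linear.has_derivative[OF bounded_linear_matrix_mult_right has_derivative_gram])
  have d2: "((\<lambda>V. det (?W ** gram (H + V))) has_derivative
      (\<lambda>Z. trace (?W ** (transpose ?A ** Z + transpose Z ** ?A)))) (at V)"
    by (rule has_derivative_compose[OF d1]) (simp add: gram_inv_left has_derivative_det_mat_1)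
  have "det ?W * det ?M = 1" by (metis det_mul gram_inv_left det_I)
  hence W: "det ?W > 0" using pos[of ?A] by (metis zero_less_mult_pos2 zero_less_one)
  have "- ln (det (?W ** gram (H + V))) + ln (det ?W) = objective H V" for V
    using W pos[of "H + V"] by (simp add: det_mul ln_mult objective_def gram_def)
  \<comment> \<open>At the base point the determinant is \<open>1\<close>, so differentiating the
    logarithm adds no factor.\<close>
  moreover have "((\<lambda>V. - ln (det (?W ** gram (H + V))) + ln (det ?W)) has_derivative
      (\<lambda>Z. - trace (?W ** (transpose ?A ** Z + transpose Z ** ?A)))) (at V)"
    using has_derivative_add_const[OF has_derivative_minus[OF has_derivative_ln[OF _ d2]]]
    by (simp add: gram_inv_left)
  \<comment> \<open>Both halves are the same inner product: the first by symmetry of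
    \<open>?W\<close>, the second by cyclicity of the trace.\<close>
  moreover have "trace (?W ** (transpose ?A ** Z + transpose Z ** ?A)) = 2 * (Z \<bullet> (?A ** ?W))" for Z
  proof -
    have "trace (?W ** (transpose ?A ** Z)) = Z \<bullet> (?A ** ?W)"
      by (subst inner_commute)
        (simp add: inner_matrix_trace matrix_transpose_mul transpose_gram_inv matrix_mul_assoc)
    moreover have "trace (?W ** (transpose Z ** ?A)) = Z \<bullet> (?A ** ?W)"
      by (subst trace_mul_sym) (simp add: inner_matrix_trace matrix_mul_assoc)
    ultimately show ?thesis by (simp add: matrix_add_ldistrib trace_add)
  qed
  ultimately show ?thesis by (simp add: gderiv_def mult.commute)
qed

lemma euclidean_grad_objective:
  "euclidean_grad (objective H) V = - 2 *\<^sub>R ((H + V) ** gram_inv (H + V))"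
  by (rule euclidean_grad_eq[OF gderiv_objective])

lemma euclidean_grad_lipschitz:
  assumes "norm (H + V) \<le> R" "norm (H + W) \<le> R"
  shows "norm (euclidean_grad (objective H) V - euclidean_grad (objective H) W)
    \<le> (2 + 4 * R\<^sup>2) * norm (V - W)"
proof -
  have "euclidean_grad (objective H) V - euclidean_grad (objective H) W =
      - 2 *\<^sub>R ((H + V) ** gram_inv (H + V) - (H + W) ** gram_inv (H + W))"
    by (simp add: euclidean_grad_objective scaleR_diff_right)
  hence "norm (euclidean_grad (objective H) V - euclidean_grad (objective H) W) =
      2 * norm ((H + V) ** gram_inv (H + V) - (H + W) ** gram_inv (H + W))" by simp
  also have "\<dots> \<le> 2 * ((1 + 2 * R\<^sup>2) * norm (V - W))"
    using mult_gram_inv_lipschitz[OF assms] by simp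
  finally show ?thesis by (simp add: algebra_simps)
qed

lemma norm_euclidean_grad_le: "norm (euclidean_grad (objective H) V) \<le> 2 * norm (H + V)"
  using norm_mult_gram_inv_le[of "H + V" "H + V"] by (simp add: euclidean_grad_objective)

section \<open>Products of spheres and tangent projections\<close>

lemma norm_column_le: "norm (column i A) \<le> norm (A :: real^'n^'p)"
  by (rule power2_le_imp_le) (auto simp: norm_eq_columns intro!: member_le_sum)

lemma norm_sphere_product:
  assumes "V \<in> sphere_product \<alpha>"
  shows "norm (V :: real^'n^'p) = sqrt (\<Sum>i\<in>UNIV. \<alpha> i)"
  using assms by (intro real_sqrt_unique[symmetric]) (auto simp: sphere_product_def norm_eq_columns)

lemma norm_add_sphere_product_le:
  "V \<in> sphere_product \<alpha> \<Longrightarrow> norm (H + V) \<le> radius_bound H \<alpha>"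
  unfolding radius_bound_def by (metis norm_sphere_product norm_triangle_ineq)

text \<open>Pythagoras: the removed component along \<open>v\<close> has squared norm
  \<open>(v \<bullet> g)\<^sup>2 / a\<close>.\<close>

lemma norm_tangent_proj_le:
  assumes "(norm v)\<^sup>2 = a" "a > 0"
  shows "norm (tangent_proj a v g) \<le> norm g"
proof -
  have "v \<bullet> v = a" "a \<noteq> 0" using assms by (simp_all add: power2_norm_eq_inner)
  hence "norm (tangent_proj a v g) ^ 2 = norm g ^ 2 - (v \<bullet> g)\<^sup>2 / a"
    unfolding tangent_proj_def power2_norm_eq_inner
    by (simp add: inner_diff_left inner_diff_right inner_commute[of g v] power2_eq_square)
  also have "\<dots> \<le> norm g ^ 2" using assms(2) by simp
  finally show ?thesis by (rule power2_le_imp_le) simp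
qed

lemma tangent_proj_orthogonal:
  assumes "(norm v)\<^sup>2 = a" "a > 0"
  shows "tangent_proj a v g \<bullet> v = 0"
proof -
  have "v \<bullet> v = a" "a \<noteq> 0" using assms by (simp_all add: power2_norm_eq_inner)
  thus ?thesis by (simp add: tangent_proj_def inner_diff_left inner_commute[of g v])
qed

text \<open>The vector \<open>g\<close> and its projection differ by a multiple of \<open>v\<close>,
  which is orthogonal to the projection. This evaluates the initial slope of the objective along the
  descent geodesic.\<close>

lemma inner_tangent_proj:
  assumes "(norm v)\<^sup>2 = a" "a > 0"
  shows "g \<bullet> tangent_proj a v g = (norm (tangent_proj a v g))\<^sup>2"
proof -
  let ?q = "tangent_proj a v g"
  have "g = ?q + ((v \<bullet> g) / a) *\<^sub>R v" by (simp add: tangent_proj_def)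
  hence "g \<bullet> ?q = (?q + ((v \<bullet> g) / a) *\<^sub>R v) \<bullet> ?q" by metis
  also have "\<dots> = ?q \<bullet> ?q + (v \<bullet> g) / a * (?q \<bullet> v)"
    by (simp add: inner_add_left inner_commute[of v ?q])
  finally show ?thesis
    using tangent_proj_orthogonal[OF assms, of g] by (simp add: power2_norm_eq_inner)
qed

section \<open>Geodesics on a sphere\<close>

text \<open>The chord of angle \<theta> is twice the absolute sine of \<theta>/2, hence at most the
  arc. The orthonormal pair is abstract because it is used for positions with \<open>u\<close>,
  \<open>w\<close> and for velocities with \<open>w\<close>, \<open>- u\<close>.\<close>

lemma circle_bounds:
  fixes u w :: "'a :: real_inner"
  assumes "norm u = 1" "norm w = 1" "u \<bullet> w = 0"
  shows "norm (cos \<theta> *\<^sub>R u + sin \<theta> *\<^sub>R w) = 1"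
    and "norm (cos \<theta> *\<^sub>R u + sin \<theta> *\<^sub>R w - u) \<le> \<bar>\<theta>\<bar>"
proof -
  have uw: "u \<bullet> u = 1" "w \<bullet> w = 1" "w \<bullet> u = 0"
    using assms by (simp_all add: norm_eq_1 inner_commute)
  show "norm (cos \<theta> *\<^sub>R u + sin \<theta> *\<^sub>R w) = 1"
    by (simp add: norm_eq_1 inner_add_left inner_add_right uw assms(3) flip: power2_eq_square)
  have "(norm (cos \<theta> *\<^sub>R u + sin \<theta> *\<^sub>R w - u))\<^sup>2 = (sin \<theta>)\<^sup>2 + (cos \<theta>)\<^sup>2 + 1 - 2 * cos \<theta>"
    unfolding power2_norm_eq_inner
    by (simp add: inner_add_left inner_add_right inner_diff_left inner_diff_right uw assms(3))
      (simp add: power2_eq_square algebra_simps)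
  also have "\<dots> = 2 - 2 * cos (2 * (\<theta> / 2))" by simp
  also have "\<dots> = (2 * \<bar>sin (\<theta> / 2)\<bar>)\<^sup>2" unfolding cos_double_sin by (simp add: power_mult_distrib)
  also have "\<dots> \<le> (2 * \<bar>\<theta> / 2\<bar>)\<^sup>2"
    by (intro power_mono mult_left_mono abs_sin_x_le_abs_x) auto
  also have "2 * \<bar>\<theta> / 2\<bar> = \<bar>\<theta>\<bar>" by simp
  finally show "norm (cos \<theta> *\<^sub>R u + sin \<theta> *\<^sub>R w - u) \<le> \<bar>\<theta>\<bar>"
    by (rule power2_le_imp_le) simp
qed

text \<open>For tangent \<open>d\<close>, this is the exponential of \<open>t *\<^sub>R d\<close> at
  \<open>v\<close> on the sphere of squared radius \<open>a\<close>, written in the shape used by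
  \<open>rbcd_update\<close>.\<close>

definition sphere_geodesic :: "real \<Rightarrow> 'a \<Rightarrow> 'a \<Rightarrow> real \<Rightarrow> 'a :: real_inner" where
  "sphere_geodesic a v d t =
     (if d = 0 then v
      else cos (t * norm d / sqrt a) *\<^sub>R v +
        sin (t * norm d / sqrt a) *\<^sub>R (sqrt a *\<^sub>R ((1 / norm d) *\<^sub>R d)))"

text \<open>The time derivative of \<open>sphere_geodesic\<close>; at \<open>d = 0\<close> the
  formula evaluates to \<open>0\<close>, as the constant curve requires.\<close>

definition geodesic_velocity :: "real \<Rightarrow> 'a \<Rightarrow> 'a \<Rightarrow> real \<Rightarrow> 'a :: real_inner" where
  "geodesic_velocity a v d t =
     cos (t * norm d / sqrt a) *\<^sub>R d - (sin (t * norm d / sqrt a) * (norm d / sqrt a)) *\<^sub>R v"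

lemma geodesic_has_velocity:
  assumes "a > 0"
  shows "(sphere_geodesic a v d has_vector_derivative geodesic_velocity a v d t) (at t)"
proof (cases "d = 0")
  case False
  define c w where "c = norm d / sqrt a" and "w = sqrt a *\<^sub>R ((1 / norm d) *\<^sub>R d)"
  have cw: "c *\<^sub>R w = d" using False assms by (simp add: c_def w_def)
  have "((\<lambda>t. cos (t * c)) has_real_derivative - sin (t * c) * c) (at t)"
    "((\<lambda>t. sin (t * c)) has_real_derivative cos (t * c) * c) (at t)"
    by (auto intro!: derivative_eq_intros)
  hence "((\<lambda>t. cos (t * c) *\<^sub>R v + sin (t * c) *\<^sub>R w) has_vector_derivative
      (cos (t * c) *\<^sub>R 0 + (- sin (t * c) * c) *\<^sub>R v) +
      (cos (t * c) * c) *\<^sub>R w) (at t)"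
    by (intro has_vector_derivative_add has_vector_derivative_scaleR has_vector_derivative_const)
      (auto dest: has_vector_derivative_scaleR[OF _ has_vector_derivative_const])
  also have "(cos (t * c) *\<^sub>R 0 + (- sin (t * c) * c) *\<^sub>R v) + (cos (t * c) * c) *\<^sub>R w =
      geodesic_velocity a v d t"
    unfolding scaleR_scaleR[of _ c w, symmetric] cw by (simp add: geodesic_velocity_def c_def)
  finally show ?thesis using False by (simp add: sphere_geodesic_def[abs_def] c_def w_def)
qed (simp add: sphere_geodesic_def[abs_def] geodesic_velocity_def)

context
  fixes a :: real and v d :: "'a :: real_inner"
  assumes a: "(norm v)\<^sup>2 = a" "a > 0" and orth: "d \<bullet> v = 0"
begin

lemma norm_base_point: "norm v = sqrt a"
  using a by (metis norm_ge_zero real_sqrt_unique)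

text \<open>For nonzero \<open>d\<close>, normalize \<open>v\<close> to \<open>u\<close> and
  \<open>d\<close> to \<open>w\<close>. The position is \<open>u\<close> rotated towards
  \<open>w\<close> and scaled by \<open>sqrt a\<close>; the velocity is \<open>w\<close> rotated
  towards \<open>- u\<close> and scaled by \<open>norm d\<close>. Both angles are
  \<open>\<theta>\<close>, so \<open>circle_bounds\<close> covers all four claims.\<close>

lemma norm_geodesic: "norm (sphere_geodesic a v d t) = sqrt a"
  and geodesic_dist_le: "norm (sphere_geodesic a v d t - v) \<le> \<bar>t\<bar> * norm d"
  and norm_velocity: "norm (geodesic_velocity a v d t) = norm d"
  and velocity_dist_le: "norm (geodesic_velocity a v d t - d) \<le> \<bar>t\<bar> * (norm d)\<^sup>2 / sqrt a"
proof -
  define u w \<theta> where "u = (1 / sqrt a) *\<^sub>R v" and "w = (1 / norm d) *\<^sub>R d"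
    and "\<theta> = t * norm d / sqrt a"
  have v: "v = sqrt a *\<^sub>R u" using a(2) by (simp add: u_def)
  have goals: "norm (sphere_geodesic a v d t) = sqrt a \<and>
      norm (sphere_geodesic a v d t - v) \<le> \<bar>t\<bar> * norm d \<and>
      norm (geodesic_velocity a v d t) = norm d \<and>
      norm (geodesic_velocity a v d t - d) \<le> \<bar>t\<bar> * (norm d)\<^sup>2 / sqrt a"
  proof (cases "d = 0")
    case True
    thus ?thesis by (simp add: sphere_geodesic_def geodesic_velocity_def norm_base_point)
  next
    case False
    have u1: "norm u = 1" "norm w = 1" "u \<bullet> w = 0" "norm (- u) = 1" "w \<bullet> (- u) = 0"
      using a(2) False orth norm_base_point by (simp_all add: u_def w_def inner_commute)
    note c = circle_bounds[OF u1(1-3), of \<theta>] circle_bounds[OF u1(2,4,5), of \<theta>]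
    have g: "sphere_geodesic a v d t = sqrt a *\<^sub>R (cos \<theta> *\<^sub>R u + sin \<theta> *\<^sub>R w)"
      using False v by (simp add: sphere_geodesic_def \<theta>_def w_def algebra_simps)
    hence gd: "sphere_geodesic a v d t - v = sqrt a *\<^sub>R (cos \<theta> *\<^sub>R u + sin \<theta> *\<^sub>R w - u)"
      using v by (simp add: algebra_simps)
    have h: "geodesic_velocity a v d t = norm d *\<^sub>R (cos \<theta> *\<^sub>R w + sin \<theta> *\<^sub>R (- u))"
      using False by (simp add: geodesic_velocity_def \<theta>_def u_def w_def algebra_simps)
    hence hd: "geodesic_velocity a v d t - d = norm d *\<^sub>R (cos \<theta> *\<^sub>R w + sin \<theta> *\<^sub>R (- u) - w)"
      using False by (simp add: w_def algebra_simps)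
    have "sqrt a * norm (cos \<theta> *\<^sub>R u + sin \<theta> *\<^sub>R w - u) \<le> sqrt a * \<bar>\<theta>\<bar>"
      using a(2) by (intro mult_left_mono c) auto
    moreover have "norm d * norm (cos \<theta> *\<^sub>R w + sin \<theta> *\<^sub>R (- u) - w) \<le> norm d * \<bar>\<theta>\<bar>"
      by (intro mult_left_mono c) auto
    ultimately show ?thesis
      unfolding gd hd unfolding g h norm_scaleR c using a(2)
      by (simp add: \<theta>_def abs_mult power2_eq_square mult_ac)
  qed
  show "norm (sphere_geodesic a v d t) = sqrt a"
    and "norm (sphere_geodesic a v d t - v) \<le> \<bar>t\<bar> * norm d"
    and "norm (geodesic_velocity a v d t) = norm d"
    and "norm (geodesic_velocity a v d t - d) \<le> \<bar>t\<bar> * (norm d)\<^sup>2 / sqrt a"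
    using goals by auto
qed

end

section \<open>Changing a single column\<close>

lemma column_set_column: "column j (set_column V i x) = (if j = i then x else column j V)"
  by (simp add: set_column_def)

lemma set_column_diff: "set_column V i x - set_column V i y = set_column 0 i (x - y)"
  unfolding matrix_eq_columns by (simp add: column_diff column_set_column) (simp add: column_def vec_eq_iff)

lemma set_column_column [simp]: "set_column V i (column i V) = V"
  unfolding matrix_eq_columns by (simp add: column_set_column)

text \<open>The map \<open>set_column 0 i\<close> is the adjoint of \<open>column i\<close>; this is
  how a derivative along block \<open>i\<close> picks out the \<open>i\<close>-th column of the
  gradient.\<close>

lemma inner_set_column_0: "set_column 0 i x \<bullet> A = x \<bullet> column i (A :: real^'n^'p)"
proof -
  have "column j (0 :: real^'n^'p) = 0" for j by (simp add: column_def vec_eq_iff)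
  hence "column j (set_column 0 i x) \<bullet> column j A = (if i = j then x \<bullet> column j A else 0)" for j
    by (auto simp: column_set_column)
  thus ?thesis unfolding inner_columns[of "set_column 0 i x"] by simp
qed

lemma norm_set_column_0: "norm (set_column 0 i x) = norm x"
  unfolding norm_eq_sqrt_inner inner_set_column_0 by (simp add: column_set_column)

text \<open>As a function of the inserted column, \<open>set_column V i\<close> is affine with
  linear part \<open>set_column 0 i\<close>.\<close>

lemma has_vector_derivative_set_column:
  assumes "(\<gamma> has_vector_derivative \<gamma>') (at t)"
  shows "((\<lambda>t. set_column (V :: real^'n^'p) i (\<gamma> t)) has_vector_derivative set_column 0 i \<gamma>') (at t)"
proof -
  have "linear (set_column (0 :: real^'n^'p) i)"
    by (rule linearI) (simp_all add: set_column_def of_columns_def column_def vec_eq_iff)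
  hence "bounded_linear (set_column (0 :: real^'n^'p) i)"
    by (simp add: linear_conv_bounded_linear)
  note lin = bounded_linear.has_vector_derivative[OF this assms]
  have "set_column V i x = set_column V i 0 + set_column 0 i x" for x
    using set_column_diff[of V i x 0] by (simp add: algebra_simps)
  hence "(\<lambda>t. set_column V i (\<gamma> t)) = (\<lambda>t. set_column V i 0 + set_column 0 i (\<gamma> t))" by metis
  thus ?thesis using has_vector_derivative_add[OF has_vector_derivative_const lin] by simp
qed

lemma column_riemannian_grad:
  "column i (riemannian_grad \<alpha> f V) = tangent_proj (\<alpha> i) (column i V) (column i (euclidean_grad f V))"
  by (simp add: riemannian_grad_def)

text \<open>The search direction is the negative \<open>i\<close>-th column of the Riemannian
  gradient, so the estimates for geodesics apply to the update.\<close>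

lemma rbcd_update_eq:
  "rbcd_update H \<alpha> \<eta> i V = set_column V i
    (sphere_geodesic (\<alpha> i) (column i V) (- column i (riemannian_grad \<alpha> (objective H) V)) (\<eta> i))"
proof -
  have "- column i (riemannian_grad \<alpha> (objective H) V) =
      - column i (euclidean_grad (objective H) V) +
        (1 / \<alpha> i) *\<^sub>R ((column i V \<bullet> column i (euclidean_grad (objective H) V)) *\<^sub>R column i V)"
    by (simp add: column_riemannian_grad tangent_proj_def)
  thus ?thesis by (simp add: rbcd_update_def Let_def sphere_geodesic_def)
qed

section \<open>Decrease of the objective in one update and in one sweep\<close>

lemma radius_bound_nonneg: "(\<And>i. \<alpha> i > 0) \<Longrightarrow> 0 \<le> radius_bound H \<alpha>"
  unfolding radius_bound_def
  by (intro add_nonneg_nonneg norm_ge_zero real_sqrt_ge_zero sum_nonneg) (simp add: less_imp_le)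

lemma block_lip_pos: "(\<And>i. \<alpha> i > 0) \<Longrightarrow> block_lip H \<alpha> i > 0"
  unfolding block_lip_def using radius_bound_nonneg[of \<alpha> H]
  by (intro add_pos_nonneg) (auto simp: less_imp_le)

text \<open>The slope along the geodesic starts at \<open>- (norm q)\<^sup>2\<close> and by time
  \<open>t\<close> has risen by at most
  \<open>block_lip H \<alpha> i * t * (norm q)\<^sup>2\<close>; integration gives the quadratic
  bound.\<close>

lemma block_descent:
  fixes H V :: "real^'n^'p" and i :: 'n
  assumes pos: "\<And>i. \<alpha> i > 0" and V: "V \<in> sphere_product \<alpha>" and "t \<ge> 0"
  defines "q \<equiv> column i (riemannian_grad \<alpha> (objective H) V)"
  shows "objective H (set_column V i (sphere_geodesic (\<alpha> i) (column i V) (- q) t))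
    \<le> objective H V - t * (norm q)\<^sup>2 + block_lip H \<alpha> i * t\<^sup>2 / 2 * (norm q)\<^sup>2"
proof -
  let ?\<gamma> = "sphere_geodesic (\<alpha> i) (column i V) (- q)"
  let ?v = "geodesic_velocity (\<alpha> i) (column i V) (- q)"
  let ?G = "euclidean_grad (objective H)"
  let ?W = "\<lambda>t. set_column V i (?\<gamma> t)"
  let ?L = "block_lip H \<alpha> i" and ?R = "radius_bound H \<alpha>"
  have a: "(norm (column i V))\<^sup>2 = \<alpha> i" using V by (simp add: sphere_product_def)
  have q: "q = tangent_proj (\<alpha> i) (column i V) (column i (?G V))"
    by (simp add: q_def column_riemannian_grad)
  have orth: "- q \<bullet> column i V = 0"
    using tangent_proj_orthogonal[OF a pos] by (simp add: q)
  note geo = norm_geodesic[OF a pos orth] geodesic_dist_le[OF a pos orth]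
    norm_velocity[OF a pos orth] velocity_dist_le[OF a pos orth]
  have W: "?W t \<in> sphere_product \<alpha>" for t
    using V pos by (auto simp: sphere_product_def column_set_column geo less_imp_le)
  have deriv: "((\<lambda>t. objective H (?W t)) has_real_derivative ?v t \<bullet> column i (?G (?W t))) (at t)" for t
  proof -
    have "((\<lambda>t. ?W t) has_derivative (\<lambda>x. x *\<^sub>R set_column 0 i (?v t))) (at t)"
      using has_vector_derivative_set_column[OF geodesic_has_velocity[OF pos[of i]]]
      by (simp add: has_vector_derivative_def)
    from has_derivative_compose[OF this objective_gderiv[unfolded gderiv_def]]
    show ?thesis by (simp add: has_field_derivative_def inner_set_column_0 mult_commute_abs)
  qed
  have slope: "?v t \<bullet> column i (?G (?W t)) + (norm q)\<^sup>2 \<le> ?L * t * (norm q)\<^sup>2" if "t \<ge> 0" for t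
  proof -
    let ?g = "column i (?G V)" and ?h = "column i (?G (?W t))"
    have dist: "norm (?W t - V) \<le> t * norm q"
    proof -
      have "?W t - V = set_column 0 i (?\<gamma> t - column i V)"
        using set_column_diff[of V i "?\<gamma> t" "column i V"] by simp
      thus ?thesis using geo(2)[of t] that by (simp add: norm_set_column_0)
    qed
    have "norm (?h - ?g) \<le> norm (?G (?W t) - ?G V)"
      using norm_column_le[of i "?G (?W t) - ?G V"] by (simp add: column_diff)
    also have "\<dots> \<le> (2 + 4 * ?R\<^sup>2) * norm (?W t - V)"
      using W V by (intro euclidean_grad_lipschitz norm_add_sphere_product_le)
    also have "\<dots> \<le> (2 + 4 * ?R\<^sup>2) * (t * norm q)"
      using dist by (intro mult_left_mono) auto
    finally have h: "norm (?h - ?g) \<le> (2 + 4 * ?R\<^sup>2) * (t * norm q)" .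
    have g: "norm ?g \<le> 2 * ?R"
      using norm_column_le[of i "?G V"] norm_euclidean_grad_le[of H V]
        norm_add_sphere_product_le[OF V, of H] by linarith
    have gq: "?g \<bullet> q = (norm q)\<^sup>2" unfolding q by (rule inner_tangent_proj[OF a pos])
    \<comment> \<open>The initial velocity is \<open>- q\<close>. The change of slope splits into
      the velocity against the change of gradient and the initial gradient against the change of
      velocity; the latter produces the term of \<open>?L\<close> with
      \<open>sqrt (\<alpha> i)\<close>.\<close>
    have "?v t \<bullet> ?h + (norm q)\<^sup>2 = ?v t \<bullet> (?h - ?g) + ?g \<bullet> (?v t - (- q))"
      by (simp add: inner_diff_right inner_add_right inner_commute gq[symmetric])
    also have "\<dots> \<le> norm (?v t) * norm (?h - ?g) + norm ?g * norm (?v t - (- q))"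
      by (intro add_mono norm_cauchy_schwarz)
    also have "\<dots> \<le> norm q * ((2 + 4 * ?R\<^sup>2) * (t * norm q)) +
        2 * ?R * (t * (norm q)\<^sup>2 / sqrt (\<alpha> i))"
      using h g geo(3,4)[of t] that radius_bound_nonneg[of \<alpha> H] pos
      by (intro add_mono mult_mono) auto
    also have "\<dots> = ?L * t * (norm q)\<^sup>2"
      by (simp add: block_lip_def power2_eq_square algebra_simps)
    finally show ?thesis .
  qed
  \<comment> \<open>The slope bound is integrated through monotonicity: it says that
    \<open>?\<psi>\<close>, the objective minus the nonconstant part of its quadratic model, has
    nonpositive derivative.\<close>
  let ?\<psi> = "\<lambda>t. objective H (?W t) + t * (norm q)\<^sup>2 - ?L * t\<^sup>2 / 2 * (norm q)\<^sup>2"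
  have "?\<psi> t \<le> ?\<psi> 0"
  proof (rule DERIV_nonpos_imp_nonincreasing[OF \<open>t \<ge> 0\<close>])
    fix x :: real assume "0 \<le> x"
    have "(?\<psi> has_real_derivative
        ?v x \<bullet> column i (?G (?W x)) + (norm q)\<^sup>2 - ?L * x * (norm q)\<^sup>2) (at x)"
      by (rule derivative_eq_intros deriv refl | simp)+
    thus "\<exists>y. (?\<psi> has_real_derivative y) (at x) \<and> y \<le> 0"
      using slope[OF \<open>0 \<le> x\<close>] by force
  qed
  moreover have "?W 0 = V" by (simp add: sphere_geodesic_def)
  ultimately show ?thesis by simp
qed

text \<open>The step \<open>1 / block_lip H \<alpha> i\<close> minimizes the quadratic bound of
  \<open>block_descent\<close>, where half of the first-order decrease remains.\<close>

lemma rbcd_update_properties: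
  fixes H V :: "real^'n^'p" and i :: 'n
  assumes pos: "\<And>i. \<alpha> i > 0" and V: "V \<in> sphere_product \<alpha>"
  defines "q \<equiv> column i (riemannian_grad \<alpha> (objective H) V)"
    and "U \<equiv> rbcd_update H \<alpha> (\<lambda>i. 1 / block_lip H \<alpha> i) i V"
  shows "U \<in> sphere_product \<alpha>"
    and "j \<noteq> i \<Longrightarrow> column j U = column j V"
    and "norm (column i U - column i V) \<le> norm q / block_lip H \<alpha> i"
    and "objective H U \<le> objective H V - (norm q)\<^sup>2 / (2 * block_lip H \<alpha> i)"
proof -
  let ?L = "block_lip H \<alpha> i"
  have U: "U = set_column V i (sphere_geodesic (\<alpha> i) (column i V) (- q) (1 / ?L))"
    by (simp add: U_def q_def rbcd_update_eq)
  have L: "?L > 0" using pos by (rule block_lip_pos)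
  have a: "(norm (column i V))\<^sup>2 = \<alpha> i" using V by (simp add: sphere_product_def)
  have orth: "- q \<bullet> column i V = 0"
    using tangent_proj_orthogonal[OF a pos] by (simp add: q_def column_riemannian_grad)
  show "U \<in> sphere_product \<alpha>"
    using V pos norm_geodesic[OF a pos orth]
    by (auto simp: U sphere_product_def column_set_column less_imp_le)
  show "column j U = column j V" if "j \<noteq> i" using that by (simp add: U column_set_column)
  show "norm (column i U - column i V) \<le> norm q / ?L"
    using geodesic_dist_le[OF a pos orth, of "1 / ?L"] L by (simp add: U column_set_column)
  have "objective H U \<le> objective H V - 1 / ?L * (norm q)\<^sup>2 + ?L * (1 / ?L)\<^sup>2 / 2 * (norm q)\<^sup>2"
    unfolding U q_def using L by (intro block_descent pos V) auto
  also have "\<dots> = objective H V - (norm q)\<^sup>2 / (2 * ?L)"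
    using L by (simp add: power2_eq_square field_simps)
  finally show "objective H U \<le> objective H V - (norm q)\<^sup>2 / (2 * ?L)" .
qed

text \<open>
  Here \<open>q j\<close> is the norm of the \<open>j\<close>-th column of the Riemannian gradient at the moment block \<open>j\<close> is
  updated. The sum over all other visited blocks is a weakening of the sum over the preceding
  ones; it spares keeping track of the order.
\<close>

lemma rbcd_fold_progress:
  fixes H V :: "real^'n^'p"
  assumes pos: "\<And>i. \<alpha> i > 0" and V: "V \<in> sphere_product \<alpha>" and "distinct xs"
  defines "W \<equiv> fold (rbcd_update H \<alpha> (\<lambda>i. 1 / block_lip H \<alpha> i)) xs V"
    and "K \<equiv> 2 + 4 * (radius_bound H \<alpha>)\<^sup>2"
  shows "W \<in> sphere_product \<alpha> \<and> (\<exists>q.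
    (\<forall>j. j \<notin> set xs \<longrightarrow> column j W = column j V) \<and>
    (\<forall>j\<in>set xs. norm (column j W - column j V) \<le> q j / block_lip H \<alpha> j) \<and>
    objective H W \<le> objective H V - (\<Sum>j\<in>set xs. (q j)\<^sup>2 / (2 * block_lip H \<alpha> j)) \<and>
    (\<forall>j\<in>set xs. (norm (column j (riemannian_grad \<alpha> (objective H) V)))\<^sup>2
      \<le> 2 * (q j)\<^sup>2 + 2 * K\<^sup>2 * (\<Sum>k\<in>set xs - {j}. (q k / block_lip H \<alpha> k)\<^sup>2)))"
  using assms(3) unfolding W_def
proof (induction xs rule: rev_induct)
  case Nil
  thus ?case using V by auto
next
  case (snoc i xs)
  let ?L = "block_lip H \<alpha>" and ?g = "riemannian_grad \<alpha> (objective H)"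
  let ?G = "euclidean_grad (objective H)"
  define X where "X = fold (rbcd_update H \<alpha> (\<lambda>i. 1 / ?L i)) xs V"
  define U where "U = rbcd_update H \<alpha> (\<lambda>i. 1 / ?L i) i X"
  have fold: "fold (rbcd_update H \<alpha> (\<lambda>i. 1 / ?L i)) (xs @ [i]) V = U"
    by (simp add: X_def U_def)
  have i: "i \<notin> set xs" using snoc.prems by simp
  from snoc obtain q where X: "X \<in> sphere_product \<alpha>"
    and fixed: "\<And>j. j \<notin> set xs \<Longrightarrow> column j X = column j V"
    and step: "\<And>j. j \<in> set xs \<Longrightarrow> norm (column j X - column j V) \<le> q j / ?L j"
    and decr: "objective H X \<le> objective H V - (\<Sum>j\<in>set xs. (q j)\<^sup>2 / (2 * ?L j))"
    and grad: "\<And>j. j \<in> set xs \<Longrightarrow> (norm (column j (?g V)))\<^sup>2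
      \<le> 2 * (q j)\<^sup>2 + 2 * K\<^sup>2 * (\<Sum>k\<in>set xs - {j}. (q k / ?L k)\<^sup>2)"
    unfolding X_def by auto
  note U = rbcd_update_properties[OF pos X, where i = i and H = H, folded U_def]
  \<comment> \<open>Block \<open>i\<close> is updated at \<open>X\<close>, so its gradient norm is
    recorded there; the entries of earlier blocks are kept.\<close>
  define q' where "q' = q(i := norm (column i (?g X)))"
  have q': "q' i = norm (column i (?g X))" "\<And>j. j \<in> set xs \<Longrightarrow> q' j = q j"
    using i by (auto simp: q'_def)
  have "U \<in> sphere_product \<alpha>" by (rule U(1))
  moreover have "column j U = column j V" if "j \<notin> set (xs @ [i])" for j
    using that fixed U(2) by auto
  moreover have "norm (column j U - column j V) \<le> q' j / ?L j" if "j \<in> set (xs @ [i])" for j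
    using that step[of j] U(2)[of j] U(3) fixed[OF i] i by (cases "j = i") (auto simp: q')
  moreover have "objective H U \<le> objective H V - (\<Sum>j\<in>set (xs @ [i]). (q' j)\<^sup>2 / (2 * ?L j))"
    using decr U(4) i by (simp add: q')
  moreover have "(norm (column j (?g V)))\<^sup>2
      \<le> 2 * (q' j)\<^sup>2 + 2 * K\<^sup>2 * (\<Sum>k\<in>set (xs @ [i]) - {j}. (q' k / ?L k)\<^sup>2)"
    if j: "j \<in> set (xs @ [i])" for j
  proof (cases "j = i")
    case True
    have "(norm (X - V))\<^sup>2 = (\<Sum>k\<in>UNIV. (norm (column k X - column k V))\<^sup>2)"
      by (simp add: norm_eq_columns column_diff)
    also have "\<dots> = (\<Sum>k\<in>set xs. (norm (column k X - column k V))\<^sup>2)"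
      by (rule sum.mono_neutral_right) (auto simp: fixed)
    also have "\<dots> \<le> (\<Sum>k\<in>set xs. (q' k / ?L k)\<^sup>2)"
      by (intro sum_mono power_mono) (auto simp: q' step)
    finally have dist: "(norm (X - V))\<^sup>2 \<le> (\<Sum>k\<in>set xs. (q' k / ?L k)\<^sup>2)" .
    \<comment> \<open>The \<open>i\<close>-th columns of \<open>X\<close> and \<open>V\<close>
      agree, so one and the same projection acts on both gradients and the Euclidean Lipschitz
      constant \<open>K\<close> suffices.\<close>
    have "column i (?g V) - column i (?g X) =
        tangent_proj (\<alpha> i) (column i V) (column i (?G V - ?G X))"
      using fixed[OF i]
      by (simp add: column_riemannian_grad tangent_proj_def column_diff inner_diff_right algebra_simps)
    hence "norm (column i (?g V) - column i (?g X)) \<le> norm (column i (?G V - ?G X))"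
      using V pos[of i] by (simp add: norm_tangent_proj_le sphere_product_def)
    also have "\<dots> \<le> norm (?G V - ?G X)" by (rule norm_column_le)
    also have "\<dots> \<le> K * norm (V - X)"
      unfolding K_def using V X by (intro euclidean_grad_lipschitz norm_add_sphere_product_le)
    finally have "norm (column i (?g V)) \<le> q' i + K * norm (X - V)"
      using norm_triangle_ineq2[of "column i (?g V)" "column i (?g X)"]
      by (simp add: q'(1) norm_minus_commute[of V X])
    hence "(norm (column i (?g V)))\<^sup>2 \<le> (q' i + K * norm (X - V))\<^sup>2"
      by (intro power_mono) auto
    also have "\<dots> \<le> 2 * (q' i)\<^sup>2 + 2 * K\<^sup>2 * (norm (X - V))\<^sup>2"
      using zero_le_power2[of "q' i - K * norm (X - V)"]
      by (simp add: power2_sum power2_diff power_mult_distrib)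
    also have "\<dots> \<le> 2 * (q' i)\<^sup>2 + 2 * K\<^sup>2 * (\<Sum>k\<in>set xs. (q' k / ?L k)\<^sup>2)"
      using dist by (intro add_left_mono mult_left_mono) auto
    finally show ?thesis using True i by simp
  next
    case False
    hence j: "j \<in> set xs" using j by simp
    \<comment> \<open>For a block visited earlier, the new index only adds a nonnegative term to the
      bound.\<close>
    have "(\<Sum>k\<in>set xs - {j}. (q k / ?L k)\<^sup>2) = (\<Sum>k\<in>set xs - {j}. (q' k / ?L k)\<^sup>2)"
      by (intro sum.cong) (auto simp: q')
    also have "\<dots> \<le> (\<Sum>k\<in>set (xs @ [i]) - {j}. (q' k / ?L k)\<^sup>2)"
      by (intro sum_mono2) auto
    finally have "2 * K\<^sup>2 * (\<Sum>k\<in>set xs - {j}. (q k / ?L k)\<^sup>2)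
        \<le> 2 * K\<^sup>2 * (\<Sum>k\<in>set (xs @ [i]) - {j}. (q' k / ?L k)\<^sup>2)"
      by (intro mult_left_mono) auto
    thus ?thesis using grad[OF j] j by (simp only: q')
  qed
  ultimately show ?case unfolding fold by blast
qed

text \<open>Both sides are compared with \<open>Q\<close>, the sum of the squared norms recorded
  during the sweep: the objective falls by at least \<open>Q / (2 * m)\<close>, and the squared
  gradient norm at the start is at most \<open>2 * P * Q / l\<^sup>2\<close>.\<close>

lemma rbcd_sweep_decrease:
  fixes H V :: "real^('n::{finite,linorder})^'p"
  assumes pos: "\<And>i. \<alpha> i > 0" and V: "V \<in> sphere_product \<alpha>"
  defines "W \<equiv> rbcd_sweep H \<alpha> (\<lambda>i. 1 / block_lip H \<alpha> i) V"
  shows "W \<in> sphere_product \<alpha>"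
    and "rate_const H \<alpha> > 0"
    and "objective H W
      \<le> objective H V - rate_const H \<alpha> * (norm (riemannian_grad \<alpha> (objective H) V))\<^sup>2"
proof -
  let ?L = "block_lip H \<alpha>" and ?g = "riemannian_grad \<alpha> (objective H) V"
  define K where "K = 2 + 4 * (radius_bound H \<alpha>)\<^sup>2"
  define l where "l = Min (range ?L)"
  define m where "m = Max (range ?L)"
  define L where "L = global_lip H \<alpha>"
  define N where "N = real CARD('n)"
  have l: "l > 0" "\<And>i. l \<le> ?L i" using block_lip_pos[OF pos, where H = H] by (auto simp: l_def)
  have m: "\<And>i. ?L i \<le> m" by (auto simp: m_def)
  hence "m > 0" using l by (meson less_le_trans)
  have N: "N \<ge> 1" by (simp add: N_def Suc_leI)
  \<comment> \<open>Relaxing \<open>K\<close> to the global constant, which adds a curvature term,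
    leads to the form of \<open>rate_const\<close>.\<close>
  have KL: "0 \<le> K" "K \<le> L"
    using radius_bound_nonneg[of \<alpha> H] pos
    by (auto simp: K_def L_def global_lip_def less_imp_le intro!: mult_nonneg_nonneg divide_nonneg_nonneg)
  define P where "P = l\<^sup>2 + L\<^sup>2 * (N * (N - 1))"
  have P: "P > 0" unfolding P_def using l N by (intro add_pos_nonneg) auto
  have rate: "rate_const H \<alpha> = l\<^sup>2 / (4 * m * P)"
    by (simp add: rate_const_def Let_def l_def m_def L_def N_def P_def)
  show "rate_const H \<alpha> > 0" unfolding rate using l \<open>m > 0\<close> P by simp
  have "distinct (sorted_list_of_set (UNIV :: 'n set))" by simp
  from rbcd_fold_progress[OF pos V this, where H = H]
  obtain q where W: "W \<in> sphere_product \<alpha>"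
    and decr: "objective H W \<le> objective H V - (\<Sum>j\<in>UNIV. (q j)\<^sup>2 / (2 * ?L j))"
    and grad: "\<And>j. (norm (column j ?g))\<^sup>2
      \<le> 2 * (q j)\<^sup>2 + 2 * K\<^sup>2 * (\<Sum>k\<in>UNIV - {j}. (q k / ?L k)\<^sup>2)"
    unfolding W_def rbcd_sweep_def K_def by auto
  show "W \<in> sphere_product \<alpha>" by (rule W)
  define Q where "Q = (\<Sum>j\<in>UNIV. (q j)\<^sup>2)"
  have Q: "Q \<ge> 0" by (simp add: Q_def sum_nonneg)
  have "(norm ?g)\<^sup>2 \<le> (\<Sum>j\<in>UNIV. 2 * (q j)\<^sup>2 + 2 * L\<^sup>2 / l\<^sup>2 * (Q - (q j)\<^sup>2))"
    unfolding norm_eq_columns[of ?g]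
  proof (rule sum_mono)
    fix j
    have "(\<Sum>k\<in>UNIV - {j}. (q k / ?L k)\<^sup>2) \<le> (\<Sum>k\<in>UNIV - {j}. (q k)\<^sup>2 / l\<^sup>2)"
      unfolding power_divide using l block_lip_pos[OF pos, where H = H]
      by (intro sum_mono divide_left_mono power_mono mult_pos_pos zero_less_power) auto
    also have "\<dots> = (Q - (q j)\<^sup>2) / l\<^sup>2"
      by (simp add: Q_def sum_diff1 sum_divide_distrib[symmetric])
    finally have "2 * K\<^sup>2 * (\<Sum>k\<in>UNIV - {j}. (q k / ?L k)\<^sup>2) \<le> 2 * L\<^sup>2 * ((Q - (q j)\<^sup>2) / l\<^sup>2)"
      using KL by (intro mult_mono) (auto intro: sum_nonneg)
    thus "(norm (column j ?g))\<^sup>2 \<le> 2 * (q j)\<^sup>2 + 2 * L\<^sup>2 / l\<^sup>2 * (Q - (q j)\<^sup>2)"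
      using grad[of j] by simp
  qed
  \<comment> \<open>Each square is left out only in the summand of its own column, so it is counted
    \<open>N - 1\<close> times.\<close>
  also have "\<dots> = 2 * Q + 2 * L\<^sup>2 / l\<^sup>2 * ((N - 1) * Q)"
    unfolding sum.distrib sum_distrib_left[symmetric] sum_subtractf
    by (simp add: N_def Q_def[symmetric] left_diff_distrib)
  \<comment> \<open>The extra factor \<open>N\<close>, at least \<open>1\<close>, produces the
    \<open>N * (N - 1)\<close> inside \<open>P\<close>.\<close>
  also have "\<dots> \<le> 2 * Q + 2 * L\<^sup>2 / l\<^sup>2 * (N * (N - 1) * Q)"
    using N Q mult_right_mono[of 1 N "N - 1"] by (intro add_left_mono mult_left_mono mult_right_mono) auto
  also have "\<dots> = 2 * P * Q / l\<^sup>2" using l by (simp add: P_def field_simps)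
  finally have "rate_const H \<alpha> * (norm ?g)\<^sup>2 \<le> rate_const H \<alpha> * (2 * P * Q / l\<^sup>2)"
    using \<open>rate_const H \<alpha> > 0\<close> by (intro mult_left_mono) auto
  also have "\<dots> = Q / (2 * m)" unfolding rate using l P \<open>m > 0\<close> by (simp add: field_simps)
  also have "\<dots> \<le> (\<Sum>j\<in>UNIV. (q j)\<^sup>2 / (2 * ?L j))"
    unfolding Q_def sum_divide_distrib using m block_lip_pos[OF pos, where H = H] \<open>m > 0\<close>
    by (intro sum_mono divide_left_mono) auto
  finally show "objective H W \<le> objective H V - rate_const H \<alpha> * (norm ?g)\<^sup>2"
    using decr by linarith
qed

section \<open>Vanishing gradient and limit points\<close>

lemma rbcd_init_in_sphere_product:
  assumes "\<And>i. \<alpha> i > 0" and "\<And>i. init_direction H \<epsilon> i \<noteq> 0"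
  shows "rbcd_init H \<alpha> \<epsilon> \<in> sphere_product \<alpha>"
  using assms by (simp add: rbcd_init_def sphere_product_def less_imp_le)

text \<open>A convergent sequence and its limit lie in a common ball, where the Euclidean gradient
  is Lipschitz; the projection depends continuously on the matrix and the gradient.\<close>

lemma riemannian_grad_tendsto:
  fixes H W :: "real^'n^'p"
  assumes X: "X \<longlonglongrightarrow> W"
  shows "(\<lambda>k. riemannian_grad \<alpha> (objective H) (X k)) \<longlonglongrightarrow> riemannian_grad \<alpha> (objective H) W"
proof -
  let ?G = "euclidean_grad (objective H)"
  have "Bseq (\<lambda>k. H + X k)"
    by (rule convergent_imp_Bseq[OF convergentI[OF tendsto_add[OF tendsto_const X]]])
  then obtain B where B: "\<And>k. norm (H + X k) \<le> B" unfolding Bseq_def by blast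
  define R where "R = max B (norm (H + W))"
  have lim: "(\<lambda>k. (2 + 4 * R\<^sup>2) * norm (X k - W)) \<longlonglongrightarrow> 0"
    by (rule tendsto_eq_intros X refl | simp)+
  have "norm (?G (X k) - ?G W) \<le> (2 + 4 * R\<^sup>2) * norm (X k - W)" for k
    using B[of k] by (intro euclidean_grad_lipschitz) (auto simp: R_def)
  hence "(\<lambda>k. ?G (X k) - ?G W) \<longlonglongrightarrow> 0"
    by (intro Lim_null_comparison[OF _ lim]) auto
  hence G: "(\<lambda>k. ?G (X k)) \<longlonglongrightarrow> ?G W" by (rule LIM_zero_cancel)
  show ?thesis
    unfolding riemannian_grad_def of_columns_def tangent_proj_def column_def
    by (intro tendsto_intros tendsto_vec_lambda X G)
qed

theorem theorem6:
  fixes H :: "real^('n::{finite,linorder})^'p"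
    and \<alpha> :: "'n \<Rightarrow> real"
    and \<epsilon> :: "'n \<Rightarrow> real^'p"
    and V :: "nat \<Rightarrow> real^('n::{finite,linorder})^'p"
  assumes "\<And>i. \<alpha> i > 0"
    and "\<And>i. init_direction H \<epsilon> i \<noteq> 0"
    and "V = rbcd_iterate H \<alpha> (\<lambda>i. 1 / block_lip H \<alpha> i) \<epsilon>"
  shows "(\<lambda>k. norm (riemannian_grad \<alpha> (objective H) (V k))) \<longlonglongrightarrow> 0
    \<and> (\<forall>k\<ge>1. (MIN s\<in>{0..k}. norm (riemannian_grad \<alpha> (objective H) (V s)))
          \<le> sqrt ((objective H (V 0) - objective_min H \<alpha>) / (rate_const H \<alpha> * real k)))
    \<and> (\<forall>Vinf\<in>sphere_product \<alpha>.
          (\<exists>r. strict_mono r \<and> (V \<circ> r) \<longlonglongrightarrow> Vinf)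
          \<longrightarrow> riemannian_grad \<alpha> (objective H) Vinf = 0)"
proof -
  let ?n = "\<lambda>k. norm (riemannian_grad \<alpha> (objective H) (V k))"
  let ?C = "rate_const H \<alpha>" and ?D = "objective H (V 0) - objective_min H \<alpha>"
  have V0: "V 0 \<in> sphere_product \<alpha>"
    using rbcd_init_in_sphere_product[OF assms(1,2)] by (simp add: assms(3) rbcd_iterate_def)
  have VS: "V (Suc k) = rbcd_sweep H \<alpha> (\<lambda>i. 1 / block_lip H \<alpha> i) (V k)" for k
    by (simp add: assms(3) rbcd_iterate_def)
  have V: "V k \<in> sphere_product \<alpha>" for k
    by (induction k) (simp_all add: V0 VS rbcd_sweep_decrease(1) assms(1))
  have C: "?C > 0" by (rule rbcd_sweep_decrease(2)[OF assms(1) V0])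
  have decr: "?C * (?n k)\<^sup>2 \<le> objective H (V k) - objective H (V (Suc k))" for k
    using rbcd_sweep_decrease(3)[OF assms(1) V[of k], where H = H] by (simp add: VS)
  \<comment> \<open>The decreases telescope to a bound independent of \<open>k\<close>, which gives
    both summability and the rate.\<close>
  have total: "?C * (\<Sum>s<k. (?n s)\<^sup>2) \<le> ?D" for k
  proof -
    have "?C * (\<Sum>s<k. (?n s)\<^sup>2) \<le> (\<Sum>s<k. objective H (V s) - objective H (V (Suc s)))"
      unfolding sum_distrib_left by (intro sum_mono decr)
    also have "\<dots> = objective H (V 0) - objective H (V k)" by (rule sum_lessThan_telescope')
    also have "\<dots> \<le> ?D" using objective_min_attained[OF assms(1), where H = H] V[of k] by auto
    finally show ?thesis .
  qed
  have "summable (\<lambda>s. (?n s)\<^sup>2)"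
    by (rule summableI_nonneg_bounded[where x = "?D / ?C"])
      (use total C in \<open>auto simp: field_simps\<close>)
  hence "(\<lambda>s. (?n s)\<^sup>2) \<longlonglongrightarrow> 0" by (rule summable_LIMSEQ_zero)
  hence lim: "?n \<longlonglongrightarrow> 0" using tendsto_real_sqrt[of "\<lambda>s. (?n s)\<^sup>2" 0] by simp
  moreover have "(MIN s\<in>{0..k}. ?n s) \<le> sqrt (?D / (?C * real k))" if "k \<ge> 1" for k
  proof (rule real_le_rsqrt)
    let ?m = "MIN s\<in>{0..k}. ?n s"
    have m: "0 \<le> ?m" by (subst Min_ge_iff) auto
    \<comment> \<open>The minimum runs over \<open>k + 1\<close> iterates, but \<open>total\<close>
      sums over the first \<open>k\<close> of them; each is at least the minimum, whence the factor
      \<open>k\<close>.\<close>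
    have "real k * ?m\<^sup>2 = (\<Sum>s<k. ?m\<^sup>2)" by simp
    also have "\<dots> \<le> (\<Sum>s<k. (?n s)\<^sup>2)"
      by (intro sum_mono power_mono m Min_le) auto
    finally have "?C * (real k * ?m\<^sup>2) \<le> ?D"
      using total[of k] C by (meson mult_left_mono less_imp_le order_trans)
    thus "?m\<^sup>2 \<le> ?D / (?C * real k)" using C that by (simp add: field_simps)
  qed
  moreover have "riemannian_grad \<alpha> (objective H) W = 0"
    if r: "strict_mono r" "(V \<circ> r) \<longlonglongrightarrow> W" for W r
  proof -
    \<comment> \<open>Along the subsequence the gradient norms tend to the norm at \<open>W\<close>
      by continuity and to \<open>0\<close> as part of a null sequence.\<close>
    have "(\<lambda>k. ?n (r k)) \<longlonglongrightarrow> norm (riemannian_grad \<alpha> (objective H) W)"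
      using tendsto_norm[OF riemannian_grad_tendsto[OF r(2), where \<alpha> = \<alpha> and H = H]] by (simp add: comp_def)
    moreover have "(\<lambda>k. ?n (r k)) \<longlonglongrightarrow> 0"
      using LIMSEQ_subseq_LIMSEQ[OF lim r(1)] by (simp add: comp_def)
    ultimately show ?thesis using LIMSEQ_unique by fastforce
  qed
  ultimately show ?thesis by blast
qed

end
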